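(* Let $n \geq 3$, let $t_1, \dots, t_n \in \mathbb{R}$ satisfy $\sum_{j=1}^n t_j = 0$ and $\sum_{j=1}^n t_j^2 = 1$, let $a, b \in \mathbb{R}$, $\sigma^2>0$, and let $Y_1,\dots,Y_n$ be independent random variables such that $Y_j - a - b t_j \sim N(0, \sigma^2)$ for $j = 1, \dots, n$. Let $\hat a, \hat b$ be the least squares (maximum likelihood) estimators of $a,b$, and let $R_j = Y_j - \hat a - \hat b t_j$, $j=1,\dots,n$, be the residuals. Let $$W_j = R_{j+2} + (A R_1 + B R_2) + (C R_1 + D R_2) t_{j+2}, \quad j = 1, \dots, n-2,$$ where either: (a) $\begin{bmatrix} A & B \\ C & D \end{bmatrix} = \dfrac{1}{(\sqrt{n}-1)(1-t_2)-t_1} \begin{bmatrix} 1-t_2 & t_1 \\ 1 & \sqrt{n}-1 \end{bmatrix}$ if $(\sqrt{n}-1)(1-t_2)-t_1 \neq 0$, and $\begin{bmatrix} A & B \\ C & D \end{bmatrix} = \dfrac{1}{\sqrt{n}-1} \begin{bmatrix} 1 & 0 \\ 0 & 0 \end{bmatrix}$ if $(\sqrt{n}-1)(1-t_2)-t_1 = 0$; or (b) $\begin{bmatrix} A & B \\ C & D \end{bmatrix} = \dfrac{-s}{(\sqrt{n}+1)+\left|(\sqrt{n}+1)t_2-t_1\right|} \begin{bmatrix} s+t_2 & -t_1 \\ -1 & \sqrt{n}+1 \end{bmatrix}$, where $s = \mathrm{sgn}\left((\sqrt{n}+1)t_2-t_1\right)$. Then (in either case) the $W_j$ are i.i.d.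 with $W_j \sim N(0,\sigma^2)$, and $\sum_{j=1}^{n-2} W_j^2 = \sum_{j=1}^{n} R_j^2$.
   Context: The least squares estimators $(\hat a,\hat b)$ are the minimizers of $\sum_{j=1}^n (Y_j - a' - b' t_j)^2$ over $a',b'\in\mathbb{R}$. Convention: $\mathrm{sgn}(y)=1$ if $y>0$, $\mathrm{sgn}(y)=-1$ if $y<0$, and $\mathrm{sgn}(0)$ may be taken to be either of $1,-1$ (it is never $0$). *)

theory Defs
  imports "HOL-Probability.Probability"
begin

definition sum_sq_dev :: "nat \<Rightarrow> (nat \<Rightarrow> real) \<Rightarrow> (nat \<Rightarrow> real) \<Rightarrow> real \<Rightarrow> real \<Rightarrow> real" where
  "sum_sq_dev n t y a' b' = (\<Sum>j=1..n. (y j - a' - b' * t j)\<^sup>2)"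

definition is_least_squares ::
    "nat \<Rightarrow> (nat \<Rightarrow> real) \<Rightarrow> (nat \<Rightarrow> real) \<Rightarrow> real \<Rightarrow> real \<Rightarrow> bool" where
  "is_least_squares n t y a' b' \<longleftrightarrow>
     is_arg_min (\<lambda>(u, v). sum_sq_dev n t y u v) (\<lambda>_. True) (a', b')"

definition residual :: "(nat \<Rightarrow> real) \<Rightarrow> (nat \<Rightarrow> 'w \<Rightarrow> real) \<Rightarrow> ('w \<Rightarrow> real) \<Rightarrow> ('w \<Rightarrow> real)
    \<Rightarrow> nat \<Rightarrow> 'w \<Rightarrow> real" where
  "residual t Y ahat bhat j \<omega> = Y j \<omega> - ahat \<omega> - bhat \<omega> * t j"

text \<open>The library function \<^const>\<open>sgn\<close> vanishes at \<open>0\<close>; here the sign is never \<open>0\<close>, and at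
  \<open>y = 0\<close> both \<open>1\<close> and \<open>-1\<close> are admissible.  Hence a relation, not a function.\<close>

definition is_sign :: "real \<Rightarrow> real \<Rightarrow> bool" where
  "is_sign y s \<longleftrightarrow> (s = 1 \<or> s = -1) \<and> (y > 0 \<longrightarrow> s = 1) \<and> (y < 0 \<longrightarrow> s = -1)"

text \<open>\<open>mat2 p q r s\<close> has rows \<open>(p, q)\<close> and \<open>(r, s)\<close>.\<close>

definition mat2 :: "real \<Rightarrow> real \<Rightarrow> real \<Rightarrow> real \<Rightarrow> real^2^2" where
  "mat2 p q r s = vector [vector [p, q], vector [r, s]]"

definition coeffs_a :: "nat \<Rightarrow> real \<Rightarrow> real \<Rightarrow> real^2^2" where
  "coeffs_a n t1 t2 =
     (let d = (sqrt (real n) - 1) * (1 - t2) - t1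
      in if d \<noteq> 0
         then (1 / d) *\<^sub>R mat2 (1 - t2) t1
                              1        (sqrt (real n) - 1)
         else (1 / (sqrt (real n) - 1)) *\<^sub>R mat2 1 0
                                                  0 0)"

text \<open>The argument \<open>s\<close> is a sign of \<open>(sqrt n + 1) * t2 - t1\<close> in the sense of \<^const>\<open>is_sign\<close>.\<close>

definition coeffs_b :: "nat \<Rightarrow> real \<Rightarrow> real \<Rightarrow> real \<Rightarrow> real^2^2" where
  "coeffs_b n t1 t2 s =
     (- s / ((sqrt (real n) + 1) + \<bar>(sqrt (real n) + 1) * t2 - t1\<bar>)) *\<^sub>R
       mat2 (s + t2) (- t1)
            (- 1)    (sqrt (real n) + 1)"

definition transformed_residual :: "(nat \<Rightarrow> real) \<Rightarrow> real \<Rightarrow> real \<Rightarrow> real \<Rightarrow> real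
    \<Rightarrow> (nat \<Rightarrow> 'w \<Rightarrow> real) \<Rightarrow> nat \<Rightarrow> 'w \<Rightarrow> real" where
  "transformed_residual t A B C D R j \<omega> =
     R (j + 2) \<omega> + (A * R 1 \<omega> + B * R 2 \<omega>) + (C * R 1 \<omega> + D * R 2 \<omega>) * t (j + 2)"

end

theory Submission
  imports Defs
begin

text \<open>
  The residual vector is the projection of the noise \<open>\<epsilon> j = Y j - a - b * t j\<close> onto the orthogonal
  complement of \<open>1\<close> and \<open>t\<close>. Put \<open>\<alpha> = A + C \<tau>\<close> and \<open>\<beta> = B + D \<tau>\<close> for \<open>\<tau> = t j\<close>, \<open>j \<ge> 3\<close>. The
  coefficients are chosen so that \<open>1 + \<alpha> + \<beta> = \<plusminus> sqrt n * \<alpha>\<close> and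
  \<open>\<tau> + \<alpha> * t 1 + \<beta> * t 2 = \<plusminus> \<beta>\<close>, which makes \<open>W\<close> the image of the noise under a matrix with
  orthonormal rows. Such a matrix is reduced by rotations of coordinate pairs to one with a single
  entry \<open>\<plusminus>1\<close> in each row, and a rotation of two coordinates preserves the joint law of i.i.d.
  centered normal variables.
\<close>

subsection \<open>Rotation invariance of the normal distribution\<close>

text \<open>Tonelli's theorem reduces the plane rotation to two one-dimensional affine
  substitutions, first in \<open>x\<close> for fixed \<open>y\<close>, then in \<open>y\<close> for
  fixed \<open>u\<close>. The factor |1 / c| left by the first is absorbed by the second, whose
  slope is \<open>1 / c\<close>. For \<open>c = 0\<close> the rotation merely swaps the coordinates
  up to signs.\<close>

lemma nn_integral_lborel_rotation:
  fixes c d :: real and h :: "real \<Rightarrow> real \<Rightarrow> ennreal"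
  assumes cd: "c\<^sup>2 + d\<^sup>2 = 1"
    and h[measurable]: "case_prod h \<in> borel_measurable (borel \<Otimes>\<^sub>M borel)"
  shows "(\<integral>\<^sup>+y. \<integral>\<^sup>+x. h (c * x + d * y) (- d * x + c * y) \<partial>lborel \<partial>lborel) =
    (\<integral>\<^sup>+y. \<integral>\<^sup>+x. h x y \<partial>lborel \<partial>lborel)"
proof (cases "c = 0")
  case True
  have d0: "d \<noteq> 0" using cd True by auto
  have ad: "\<bar>d\<bar> = 1" using cd True by (auto simp: power2_eq_1_iff)
  have "(\<integral>\<^sup>+y. \<integral>\<^sup>+x. h (c * x + d * y) (- d * x + c * y) \<partial>lborel \<partial>lborel) =
      (\<integral>\<^sup>+y. \<integral>\<^sup>+x. h (d * y) (- d * x) \<partial>lborel \<partial>lborel)"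
    using True by simp
  also have "\<dots> = (\<integral>\<^sup>+y. \<integral>\<^sup>+x. h (d * y) x \<partial>lborel \<partial>lborel)"
    using ad d0 by (subst (2) nn_integral_real_affine[where c = "- d" and t = 0]) simp_all
  also have "\<dots> = (\<integral>\<^sup>+y. \<integral>\<^sup>+x. h y x \<partial>lborel \<partial>lborel)"
    using ad d0 by (subst (3) nn_integral_real_affine[where c = d and t = 0]) simp_all
  also have "\<dots> = (\<integral>\<^sup>+y. \<integral>\<^sup>+x. h x y \<partial>lborel \<partial>lborel)"
    by (rule lborel_pair.Fubini') simp
  finally show ?thesis .
next
  case False
  \<comment> \<open>The second coordinate after solving \<open>u = c * x + d * y\<close> for
    \<open>x\<close>. By c^2 + d^2 = 1 the coefficient of \<open>y\<close> collapses to
    \<open>1 / c\<close>.\<close>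
  have e: "- d * ((u - d * y) / c) + c * y = - d / c * u + 1 / c * y" for u y
  proof -
    have "1 - d\<^sup>2 = c * c" using cd by (simp add: power2_eq_square)
    then have "c * y = (1 - d\<^sup>2) / c * y" using False by simp
    then show ?thesis using False by (simp add: field_simps power2_eq_square)
  qed
  have "(\<integral>\<^sup>+y. \<integral>\<^sup>+x. h (c * x + d * y) (- d * x + c * y) \<partial>lborel \<partial>lborel) =
      (\<integral>\<^sup>+y. \<bar>1 / c\<bar> * (\<integral>\<^sup>+u. h u (- d / c * u + 1 / c * y) \<partial>lborel) \<partial>lborel)"
  proof (intro nn_integral_cong)
    fix y
    have e1: "c * (- (d * y / c) + 1 / c * u) + d * y = u" for u
      using False by (simp add: field_simps)
    have e2: "- d * (- (d * y / c) + 1 / c * u) + c * y = - d / c * u + 1 / c * y" for u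
      using e[of u y] by (simp add: diff_divide_distrib)
    show "(\<integral>\<^sup>+x. h (c * x + d * y) (- d * x + c * y) \<partial>lborel) =
      \<bar>1 / c\<bar> * (\<integral>\<^sup>+u. h u (- d / c * u + 1 / c * y) \<partial>lborel)"
      using False
      by (subst nn_integral_real_affine[where c = "1 / c" and t = "- (d * y / c)"])
        (simp_all only: e1 e2, simp_all)
  qed
  also have "\<dots> = \<bar>1 / c\<bar> * (\<integral>\<^sup>+y. \<integral>\<^sup>+u. h u (- d / c * u + 1 / c * y) \<partial>lborel \<partial>lborel)"
    by (rule nn_integral_cmult) simp
  also have "\<dots> = \<bar>1 / c\<bar> * (\<integral>\<^sup>+u. \<integral>\<^sup>+y. h u (- d / c * u + 1 / c * y) \<partial>lborel \<partial>lborel)"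
    by (subst lborel_pair.Fubini') simp_all
  also have "\<dots> = (\<integral>\<^sup>+u. \<bar>1 / c\<bar> * (\<integral>\<^sup>+y. h u (- d / c * u + 1 / c * y) \<partial>lborel) \<partial>lborel)"
    by (rule nn_integral_cmult[symmetric]) simp
  also have "\<dots> = (\<integral>\<^sup>+u. \<integral>\<^sup>+y. h u y \<partial>lborel \<partial>lborel)"
    using False
    by (intro nn_integral_cong nn_integral_real_affine[symmetric]) simp_all
  also have "\<dots> = (\<integral>\<^sup>+y. \<integral>\<^sup>+x. h x y \<partial>lborel \<partial>lborel)"
    by (rule lborel_pair.Fubini') simp
  finally show ?thesis .
qed

definition centered_normal :: "real \<Rightarrow> real measure" where
  "centered_normal \<sigma> = density lborel (\<lambda>x. ennreal (normal_density 0 \<sigma> x))"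

lemma sets_centered_normal [simp, measurable_cong]: "sets (centered_normal \<sigma>) = sets borel"
  by (simp add: centered_normal_def)

lemma space_centered_normal [simp]: "space (centered_normal \<sigma>) = UNIV"
  by (simp add: centered_normal_def)

lemma prob_space_centered_normal: "\<sigma> > 0 \<Longrightarrow> prob_space (centered_normal \<sigma>)"
  unfolding centered_normal_def by (rule prob_space_normal_density)

text \<open>The product density depends on the point only through x^2 + y^2, which the rotation
  preserves. Hence the density can be moved into the integrand of the Lebesgue version.\<close>

lemma nn_integral_centered_normal_rotation:
  fixes c d :: real and h :: "real \<Rightarrow> real \<Rightarrow> ennreal"
  assumes cd: "c\<^sup>2 + d\<^sup>2 = 1"
    and h[measurable]: "case_prod h \<in> borel_measurable (borel \<Otimes>\<^sub>M borel)"
  shows "(\<integral>\<^sup>+y. \<integral>\<^sup>+x. h (c * x + d * y) (- d * x + c * y)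
      \<partial>centered_normal \<sigma> \<partial>centered_normal \<sigma>) =
    (\<integral>\<^sup>+y. \<integral>\<^sup>+x. h x y \<partial>centered_normal \<sigma> \<partial>centered_normal \<sigma>)"
proof -
  let ?f = "normal_density 0 \<sigma>"
  let ?H = "\<lambda>x y. ennreal (?f x * ?f y) * h x y"
  have prod: "(\<integral>\<^sup>+y. \<integral>\<^sup>+x. g x y \<partial>centered_normal \<sigma> \<partial>centered_normal \<sigma>) =
      (\<integral>\<^sup>+y. \<integral>\<^sup>+x. ennreal (?f x * ?f y) * g x y \<partial>lborel \<partial>lborel)"
    if [measurable]: "case_prod g \<in> borel_measurable (borel \<Otimes>\<^sub>M borel)"
    for g :: "real \<Rightarrow> real \<Rightarrow> ennreal"
    unfolding centered_normal_def
    by (simp add: nn_integral_density nn_integral_cmult[symmetric] ennreal_mult ac_simps)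
  have inv: "?f (c * x + d * y) * ?f (- d * x + c * y) = ?f x * ?f y" for x y
  proof -
    have "(c * x + d * y)\<^sup>2 + (- d * x + c * y)\<^sup>2 = (c\<^sup>2 + d\<^sup>2) * (x\<^sup>2 + y\<^sup>2)"
      by (simp add: power2_eq_square algebra_simps)
    then have "(c * x + d * y)\<^sup>2 + (- d * x + c * y)\<^sup>2 = x\<^sup>2 + y\<^sup>2"
      using cd by simp
    then have "- (c * x + d * y)\<^sup>2 / (2 * \<sigma>\<^sup>2) + - (- d * x + c * y)\<^sup>2 / (2 * \<sigma>\<^sup>2) =
        - x\<^sup>2 / (2 * \<sigma>\<^sup>2) + - y\<^sup>2 / (2 * \<sigma>\<^sup>2)"
      by (simp only: add_divide_distrib[symmetric])
        (simp only: minus_add_distrib[symmetric])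
    then have "exp (- (c * x + d * y)\<^sup>2 / (2 * \<sigma>\<^sup>2)) * exp (- (- d * x + c * y)\<^sup>2 / (2 * \<sigma>\<^sup>2)) =
        exp (- x\<^sup>2 / (2 * \<sigma>\<^sup>2)) * exp (- y\<^sup>2 / (2 * \<sigma>\<^sup>2))"
      by (simp only: exp_add[symmetric])
    then show ?thesis
      by (simp add: normal_density_def)
  qed
  have "(\<integral>\<^sup>+y. \<integral>\<^sup>+x. h (c * x + d * y) (- d * x + c * y)
      \<partial>centered_normal \<sigma> \<partial>centered_normal \<sigma>) =
      (\<integral>\<^sup>+y. \<integral>\<^sup>+x. ?H (c * x + d * y) (- d * x + c * y) \<partial>lborel \<partial>lborel)"
    by (subst prod) (simp_all only: inv, simp)
  also have "\<dots> = (\<integral>\<^sup>+y. \<integral>\<^sup>+x. ?H x y \<partial>lborel \<partial>lborel)"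
    by (rule nn_integral_lborel_rotation[OF cd]) simp
  also have "\<dots> = (\<integral>\<^sup>+y. \<integral>\<^sup>+x. h x y \<partial>centered_normal \<sigma> \<partial>centered_normal \<sigma>)"
    by (rule prod[symmetric]) simp
  finally show ?thesis .
qed

section \<open>Rotating two coordinates of a finite product of normal laws\<close>

text \<open>A Givens rotation in the plane of the coordinates \<open>i\<close> and \<open>j\<close>.
  Restricting to \<open>I\<close> keeps its values in the extensional function space that carries
  \<open>PiM I\<close>.\<close>

definition rotate_coords :: "'i set \<Rightarrow> 'i \<Rightarrow> 'i \<Rightarrow> real \<Rightarrow> real \<Rightarrow> ('i \<Rightarrow> real) \<Rightarrow> 'i \<Rightarrow> real" where
  "rotate_coords I i j c d x =
    (\<lambda>k\<in>I. if k = i then c * x i + d * x j else if k = j then - d * x i + c * x j else x k)"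

lemma rotate_coords_measurable [measurable]:
  assumes "i \<in> I" "j \<in> I"
  shows "rotate_coords I i j c d \<in> measurable (PiM I (\<lambda>_. borel)) (PiM I (\<lambda>_. borel))"
  unfolding rotate_coords_def using assms by (intro measurable_restrict) simp

text \<open>A finite product measure is determined by its values on boxes. On a box the coordinates
  other than \<open>i\<close> and \<open>j\<close> split off as a factor, and the remaining double
  integral is rotation invariant.\<close>

lemma distr_rotate_coords:
  assumes fin: "finite I" and I: "i \<in> I" "j \<in> I" "i \<noteq> j"
    and \<sigma>: "\<sigma> > 0" and cd: "c\<^sup>2 + d\<^sup>2 = 1"
  shows "distr (PiM I (\<lambda>_. centered_normal \<sigma>)) (PiM I (\<lambda>_. borel)) (rotate_coords I i j c d) =
    PiM I (\<lambda>_. centered_normal \<sigma>)"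
proof -
  interpret prob_space "centered_normal \<sigma>" by (rule prob_space_centered_normal[OF \<sigma>])
  interpret P: product_sigma_finite "\<lambda>_. centered_normal \<sigma>"
    by standard
  define K where "K = I - {i, j}"
  have IK: "I = insert i (insert j K)" and K: "finite K" "i \<notin> insert j K" "j \<notin> K"
    using I fin by (auto simp: K_def)
  note [measurable] = rotate_coords_measurable[OF I(1,2)]
  have setsP: "sets (PiM J (\<lambda>_. centered_normal \<sigma>)) = sets (PiM J (\<lambda>_. borel))" for J
    by (intro sets_PiM_cong) simp_all
  note [measurable_cong] = setsP
  show ?thesis
  proof (rule P.PiM_eqI[OF fin])
    show "sets (distr (PiM I (\<lambda>_. centered_normal \<sigma>)) (PiM I (\<lambda>_. borel)) (rotate_coords I i j c d)) =
        sets (PiM I (\<lambda>_. centered_normal \<sigma>))"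
      by (simp add: setsP)
  next
    fix A :: "'a \<Rightarrow> real set"
    assume "\<And>k. k \<in> I \<Longrightarrow> A k \<in> sets (centered_normal \<sigma>)"
    then have A[measurable]: "\<And>k. k \<in> I \<Longrightarrow> A k \<in> sets borel" by simp
    have [measurable]: "A i \<in> sets borel" "A j \<in> sets borel" using A I by auto
    have [measurable]: "PiE I A \<in> sets (PiM I (\<lambda>_. borel))"
      using A fin by (intro sets_PiM_I_finite) auto
    let ?N = "centered_normal \<sigma>"
    let ?h = "\<lambda>u v. indicator (A i) u * indicator (A j) v :: ennreal"
    let ?g = "\<lambda>x. indicator (PiE I A) (rotate_coords I i j c d x) :: ennreal"
    \<comment> \<open>The box condition decouples: coordinates in \<open>K\<close> are untouched,
      only \<open>u\<close> and \<open>v\<close> mix. The update at \<open>i\<close> is outermost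
      because \<open>i\<close> is the first coordinate peeled off the product below.\<close>
    have g: "?g (x(j := v, i := u)) =
        (\<Prod>k\<in>K. indicator (A k) (x k)) * ?h (c * u + d * v) (- d * u + c * v)" for x u v
    proof -
      have "rotate_coords I i j c d (x(j := v, i := u)) \<in> PiE I A \<longleftrightarrow>
          (\<forall>k\<in>K. x k \<in> A k) \<and> c * u + d * v \<in> A i \<and> - d * u + c * v \<in> A j"
        unfolding rotate_coords_def restrict_PiE_iff using I
        by (auto simp: K_def)
      then show ?thesis
        using K(1) by (auto simp: indicator_def prod_zero_iff intro!: prod.neutral[symmetric])
    qed
    have "emeasure (distr (PiM I (\<lambda>_. ?N)) (PiM I (\<lambda>_. borel)) (rotate_coords I i j c d)) (PiE I A) =
        (\<integral>\<^sup>+x. indicator (PiE I A) x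
          \<partial>distr (PiM I (\<lambda>_. ?N)) (PiM I (\<lambda>_. borel)) (rotate_coords I i j c d))"
      by simp
    also have "\<dots> = (\<integral>\<^sup>+x. ?g x \<partial>PiM I (\<lambda>_. ?N))"
      by (subst nn_integral_distr) auto
    also have "\<dots> = (\<integral>\<^sup>+x. \<integral>\<^sup>+v. \<integral>\<^sup>+u. ?g (x(j := v, i := u)) \<partial>?N \<partial>?N \<partial>PiM K (\<lambda>_. ?N))"
    proof -
      have m: "?g \<in> borel_measurable (PiM (insert i (insert j K)) (\<lambda>_. ?N))"
        unfolding IK[symmetric] by measurable
      have "(\<integral>\<^sup>+x. ?g x \<partial>PiM I (\<lambda>_. ?N)) =
          (\<integral>\<^sup>+x. \<integral>\<^sup>+u. ?g (x(i := u)) \<partial>?N \<partial>PiM (insert j K) (\<lambda>_. ?N))"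
        using P.product_nn_integral_insert[of "insert j K" i ?g] K m
        by (simp add: IK[symmetric])
      also have "\<dots> = (\<integral>\<^sup>+x. \<integral>\<^sup>+v. \<integral>\<^sup>+u. ?g (x(j := v, i := u)) \<partial>?N \<partial>?N \<partial>PiM K (\<lambda>_. ?N))"
      proof (rule P.product_nn_integral_insert[OF K(1,3)])
        have "(\<lambda>(x, u). ?g (x(i := u))) \<in> borel_measurable (PiM (insert j K) (\<lambda>_. ?N) \<Otimes>\<^sub>M ?N)"
          using measurable_compose[OF measurable_add_dim m] by (simp add: split_beta')
        then show "(\<lambda>x. \<integral>\<^sup>+u. ?g (x(i := u)) \<partial>?N) \<in> borel_measurable (PiM (insert j K) (\<lambda>_. ?N))"
          by (rule borel_measurable_nn_integral)
      qed
      finally show ?thesis .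
    qed
    also have "\<dots> = (\<integral>\<^sup>+x. (\<Prod>k\<in>K. indicator (A k) (x k)) *
        (\<integral>\<^sup>+v. \<integral>\<^sup>+u. ?h (c * u + d * v) (- d * u + c * v) \<partial>?N \<partial>?N) \<partial>PiM K (\<lambda>_. ?N))"
      unfolding g by (simp add: nn_integral_cmult)
    also have "\<dots> = (\<integral>\<^sup>+x. (\<Prod>k\<in>K. indicator (A k) (x k)) *
        (\<integral>\<^sup>+v. \<integral>\<^sup>+u. ?h u v \<partial>?N \<partial>?N) \<partial>PiM K (\<lambda>_. ?N))"
      by (subst nn_integral_centered_normal_rotation[OF cd]) simp_all
    also have "(\<integral>\<^sup>+v. \<integral>\<^sup>+u. ?h u v \<partial>?N \<partial>?N) = emeasure ?N (A i) * emeasure ?N (A j)"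
      by (simp add: nn_integral_multc nn_integral_cmult)
    also have "(\<integral>\<^sup>+x. (\<Prod>k\<in>K. indicator (A k) (x k)) * (emeasure ?N (A i) * emeasure ?N (A j))
        \<partial>PiM K (\<lambda>_. ?N)) =
        (\<integral>\<^sup>+x. (\<Prod>k\<in>K. indicator (A k) (x k)) \<partial>PiM K (\<lambda>_. ?N)) *
        (emeasure ?N (A i) * emeasure ?N (A j))"
      using A by (intro nn_integral_multc borel_measurable_prod_ennreal) (auto simp: IK)
    also have "(\<integral>\<^sup>+x. (\<Prod>k\<in>K. indicator (A k) (x k)) \<partial>PiM K (\<lambda>_. ?N)) =
        (\<Prod>k\<in>K. emeasure ?N (A k))"
      using A by (subst P.product_nn_integral_prod[OF K(1)]) (auto simp: IK)
    also have "(\<Prod>k\<in>K. emeasure ?N (A k)) * (emeasure ?N (A i) * emeasure ?N (A j)) =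
        (\<Prod>k\<in>I. emeasure ?N (A k))"
      using K by (simp add: IK ac_simps)
    finally show "emeasure (distr (PiM I (\<lambda>_. ?N)) (PiM I (\<lambda>_. borel)) (rotate_coords I i j c d))
        (PiE I A) = (\<Prod>k\<in>I. emeasure ?N (A k))" .
  qed
qed

subsection \<open>Orthonormal linear combinations of i.i.d. normal variables\<close>

text \<open>Encoded through the joint law, so that invariance of the product measure under a map
  transfers directly to random vectors. Measurability is a separate conjunct because
  \<open>distr\<close> is the image measure only for measurable maps.\<close>

definition iid_normal :: "'w measure \<Rightarrow> real \<Rightarrow> 'i set \<Rightarrow> ('i \<Rightarrow> 'w \<Rightarrow> real) \<Rightarrow> bool" where
  "iid_normal M \<sigma> I X \<longleftrightarrow> (\<forall>i\<in>I. X i \<in> borel_measurable M) \<and>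
    distr M (PiM I (\<lambda>_. borel)) (\<lambda>\<omega>. \<lambda>i\<in>I. X i \<omega>) = PiM I (\<lambda>_. centered_normal \<sigma>)"

lemma distributed_normal_iff:
  "distributed M lborel X (normal_density 0 \<sigma>) \<longleftrightarrow>
    X \<in> borel_measurable M \<and> distr M borel X = centered_normal \<sigma>"
proof -
  have "distr M lborel X = distr M borel X" by (rule distr_cong) simp_all
  then show ?thesis
    unfolding distributed_def centered_normal_def
    by (auto simp: measurable_lborel2)
qed

text \<open>Bridge to the formulation by independence and marginals: the marginals are coordinate
  projections of the product law, and independence is the factorization of the joint law.\<close>

lemma (in prob_space) iid_normal_iff:
  assumes I: "I \<noteq> {}" and \<sigma>: "\<sigma> > 0"
  shows "iid_normal M \<sigma> I X \<longleftrightarrow>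
    indep_vars (\<lambda>_. borel) X I \<and> (\<forall>i\<in>I. distributed M lborel (X i) (normal_density 0 \<sigma>))"
proof (intro iffI conjI)
  assume iid: "iid_normal M \<sigma> I X"
  then have [measurable]: "\<And>i. i \<in> I \<Longrightarrow> X i \<in> borel_measurable M"
    and joint: "distr M (PiM I (\<lambda>_. borel)) (\<lambda>\<omega>. \<lambda>i\<in>I. X i \<omega>) = PiM I (\<lambda>_. centered_normal \<sigma>)"
    by (simp_all add: iid_normal_def)
  have marg: "distr M borel (X i) = centered_normal \<sigma>" if i: "i \<in> I" for i
  proof -
    have "centered_normal \<sigma> = distr (PiM I (\<lambda>_. centered_normal \<sigma>)) (centered_normal \<sigma>) (\<lambda>x. x i)"
      using i prob_space_centered_normal[OF \<sigma>]
      by (intro distr_PiM_component[symmetric]) auto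
    also have "\<dots> = distr (distr M (PiM I (\<lambda>_. borel)) (\<lambda>\<omega>. \<lambda>i\<in>I. X i \<omega>)) borel (\<lambda>x. x i)"
      unfolding joint by (rule distr_cong) simp_all
    also have "\<dots> = distr M borel ((\<lambda>x. x i) \<circ> (\<lambda>\<omega>. \<lambda>i\<in>I. X i \<omega>))"
      using i by (intro distr_distr) (auto intro!: measurable_restrict measurable_component_singleton)
    also have "(\<lambda>x. x i) \<circ> (\<lambda>\<omega>. \<lambda>i\<in>I. X i \<omega>) = X i"
      using i by auto
    finally show ?thesis by simp
  qed
  then show "\<forall>i\<in>I. distributed M lborel (X i) (normal_density 0 \<sigma>)"
    by (simp add: distributed_normal_iff)
  have "PiM I (\<lambda>_. centered_normal \<sigma>) = PiM I (\<lambda>i. distr M borel (X i))"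
    by (rule PiM_cong) (simp_all add: marg)
  then show "indep_vars (\<lambda>_. borel) X I"
    by (subst indep_vars_iff_distr_eq_PiM'[OF I]) (simp_all add: joint)
next
  assume asm: "indep_vars (\<lambda>_. borel) X I \<and>
    (\<forall>i\<in>I. distributed M lborel (X i) (normal_density 0 \<sigma>))"
  then have [measurable]: "\<And>i. i \<in> I \<Longrightarrow> X i \<in> borel_measurable M"
    by (simp add: distributed_normal_iff)
  have "distr M (PiM I (\<lambda>_. borel)) (\<lambda>\<omega>. \<lambda>i\<in>I. X i \<omega>) = PiM I (\<lambda>i. distr M borel (X i))"
    using asm by (subst indep_vars_iff_distr_eq_PiM'[OF I, symmetric]) simp_all
  also have "\<dots> = PiM I (\<lambda>_. centered_normal \<sigma>)"
    using asm by (intro PiM_cong) (simp_all add: distributed_normal_iff)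
  finally show "iid_normal M \<sigma> I X"
    by (simp add: iid_normal_def)
qed

lemma (in prob_space) iid_normal_rotate:
  assumes X: "iid_normal M \<sigma> I X" and fin: "finite I"
    and I: "i \<in> I" "j \<in> I" "i \<noteq> j" and \<sigma>: "\<sigma> > 0" and cd: "c\<^sup>2 + d\<^sup>2 = 1"
  shows "iid_normal M \<sigma> I (\<lambda>k \<omega>. rotate_coords I i j c d (\<lambda>m. X m \<omega>) k)"
proof -
  have [measurable]: "\<And>i. i \<in> I \<Longrightarrow> X i \<in> borel_measurable M"
    and joint: "distr M (PiM I (\<lambda>_. borel)) (\<lambda>\<omega>. \<lambda>i\<in>I. X i \<omega>) = PiM I (\<lambda>_. centered_normal \<sigma>)"
    using X by (simp_all add: iid_normal_def)
  have "distr M (PiM I (\<lambda>_. borel)) (\<lambda>\<omega>. \<lambda>k\<in>I. rotate_coords I i j c d (\<lambda>m. X m \<omega>) k) =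
      distr M (PiM I (\<lambda>_. borel)) (rotate_coords I i j c d \<circ> (\<lambda>\<omega>. \<lambda>i\<in>I. X i \<omega>))"
    using I by (intro distr_cong) (auto simp: rotate_coords_def fun_eq_iff)
  also have "\<dots> = distr (PiM I (\<lambda>_. centered_normal \<sigma>)) (PiM I (\<lambda>_. borel)) (rotate_coords I i j c d)"
    unfolding joint[symmetric] using I
    by (intro distr_distr[symmetric]) (auto intro!: measurable_restrict rotate_coords_measurable)
  also have "\<dots> = PiM I (\<lambda>_. centered_normal \<sigma>)"
    by (rule distr_rotate_coords[OF fin I \<sigma> cd])
  finally show ?thesis
    unfolding iid_normal_def using I by (auto simp: rotate_coords_def)
qed

text \<open>Injectivity makes distinct indices read distinct coordinates, so the selected law is
  again a product. This serves both to pick the coordinates that survive the row reduction and to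
  shift \<open>{3..n}\<close> to \<open>{1..n-2}\<close>.\<close>

lemma (in prob_space) iid_normal_reindex:
  assumes X: "iid_normal M \<sigma> I X" and f: "inj_on f K" "f ` K \<subseteq> I" and \<sigma>: "\<sigma> > 0"
  shows "iid_normal M \<sigma> K (\<lambda>k. X (f k))"
proof -
  have [measurable]: "\<And>i. i \<in> I \<Longrightarrow> X i \<in> borel_measurable M"
    and joint: "distr M (PiM I (\<lambda>_. borel)) (\<lambda>\<omega>. \<lambda>i\<in>I. X i \<omega>) = PiM I (\<lambda>_. centered_normal \<sigma>)"
    using X by (simp_all add: iid_normal_def)
  have "distr M (PiM K (\<lambda>_. borel)) (\<lambda>\<omega>. \<lambda>k\<in>K. X (f k) \<omega>) =
      distr M (PiM K (\<lambda>_. borel)) ((\<lambda>x. \<lambda>k\<in>K. x (f k)) \<circ> (\<lambda>\<omega>. \<lambda>i\<in>I. X i \<omega>))"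
    using f by (intro distr_cong) (auto simp: fun_eq_iff)
  also have "\<dots> = distr (PiM I (\<lambda>_. centered_normal \<sigma>)) (PiM K (\<lambda>_. borel)) (\<lambda>x. \<lambda>k\<in>K. x (f k))"
    unfolding joint[symmetric] using f
    by (intro distr_distr[symmetric])
      (auto intro!: measurable_restrict measurable_component_singleton)
  also have "\<dots> = distr (PiM I (\<lambda>_. centered_normal \<sigma>)) (PiM K (\<lambda>_. centered_normal \<sigma>))
      (\<lambda>x. \<lambda>k\<in>K. x (f k))"
    by (intro distr_cong sets_PiM_cong) simp_all
  also have "\<dots> = PiM K (\<lambda>_. centered_normal \<sigma>)"
    using f prob_space_centered_normal[OF \<sigma>] by (intro distr_PiM_reindex) auto
  finally show ?thesis
    unfolding iid_normal_def using f by auto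
qed

section \<open>Reduction of orthonormal rows by rotations\<close>

text \<open>The Gram matrix of the rows is the identity. There may be fewer rows than columns: the
  application has \<open>n - 2\<close> rows over \<open>n\<close> noise variables.\<close>

definition orthonormal_rows :: "'i set \<Rightarrow> 'k set \<Rightarrow> ('k \<Rightarrow> 'i \<Rightarrow> real) \<Rightarrow> bool" where
  "orthonormal_rows I K G \<longleftrightarrow> (\<forall>k\<in>K. \<forall>l\<in>K. (\<Sum>i\<in>I. G k i * G l i) = (if k = l then 1 else 0))"

text \<open>Only the terms at \<open>i\<close> and \<open>j\<close> change, and their sum is
  multiplied by c^2 + d^2. For two rows this preserves the Gram matrix; for a row and the vector of
  variables it preserves the linear combination.\<close>

lemma sum_rotate_coords:
  assumes "finite I" "i \<in> I" "j \<in> I" "i \<noteq> j" and cd: "c\<^sup>2 + d\<^sup>2 = 1"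
  shows "(\<Sum>m\<in>I. rotate_coords I i j c d x m * rotate_coords I i j c d y m) = (\<Sum>m\<in>I. x m * y m)"
proof -
  define K where "K = I - {i, j}"
  have IK: "I = insert i (insert j K)" and K: "finite K" "i \<notin> insert j K" "j \<notin> K"
    using assms by (auto simp: K_def)
  have K_eq: "(\<Sum>m\<in>K. rotate_coords I i j c d x m * rotate_coords I i j c d y m) =
      (\<Sum>m\<in>K. x m * y m)"
    by (intro sum.cong) (auto simp: rotate_coords_def K_def)
  have "(c * x i + d * x j) * (c * y i + d * y j) + (- d * x i + c * x j) * (- d * y i + c * y j) =
      (c\<^sup>2 + d\<^sup>2) * (x i * y i + x j * y j)"
    by (simp add: algebra_simps power2_eq_square)
  then have ij: "(c * x i + d * x j) * (c * y i + d * y j) +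
      (- d * x i + c * x j) * (- d * y i + c * y j) = x i * y i + x j * y j"
    using cd by simp
  have "(\<Sum>m\<in>I. rotate_coords I i j c d x m * rotate_coords I i j c d y m) =
      rotate_coords I i j c d x i * rotate_coords I i j c d y i +
      rotate_coords I i j c d x j * rotate_coords I i j c d y j +
      (\<Sum>m\<in>K. rotate_coords I i j c d x m * rotate_coords I i j c d y m)"
    using K by (subst (1) IK) (simp add: sum.insert)
  also have "rotate_coords I i j c d x i * rotate_coords I i j c d y i +
      rotate_coords I i j c d x j * rotate_coords I i j c d y j = x i * y i + x j * y j"
    using assms(2-4) ij by (simp add: rotate_coords_def)
  also have "x i * y i + x j * y j + (\<Sum>m\<in>K. rotate_coords I i j c d x m * rotate_coords I i j c d y m) =
      (\<Sum>m\<in>I. x m * y m)"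
    using K unfolding K_eq by (subst IK) simp
  finally show ?thesis .
qed

text \<open>Givens elimination: while row \<open>k0\<close> has two nonzero entries, a rotation of
  those two columns kills one of them. Rotating variables and rows together leaves every linear
  combination unchanged, and the number of nonzero entries in row \<open>k0\<close> drops.\<close>

lemma (in prob_space) iid_normal_clear_row:
  assumes fin: "finite I" and \<sigma>: "\<sigma> > 0" and k0: "k0 \<in> K" and P: "P \<subseteq> K"
    and "iid_normal M \<sigma> I X" and "orthonormal_rows I K G"
    and "\<forall>p\<in>P. \<exists>!i. i \<in> I \<and> G p i \<noteq> 0"
  shows "\<exists>X' G'. iid_normal M \<sigma> I X' \<and> orthonormal_rows I K G' \<and>
    (\<forall>k \<omega>. (\<Sum>i\<in>I. G' k i * X' i \<omega>) = (\<Sum>i\<in>I. G k i * X i \<omega>)) \<and>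
    (\<forall>p\<in>insert k0 P. \<exists>!i. i \<in> I \<and> G' p i \<noteq> 0)"
  using assms(5-)
proof (induction "card {i \<in> I. G k0 i \<noteq> 0}" arbitrary: X G rule: less_induct)
  case less
  note X = less.prems(1) and G = less.prems(2) and GP = less.prems(3)
  show ?case
  proof (cases "\<exists>!i. i \<in> I \<and> G k0 i \<noteq> 0")
    case True
    have "\<forall>p\<in>insert k0 P. \<exists>!i. i \<in> I \<and> G p i \<noteq> 0"
    proof (intro ballI)
      fix p assume "p \<in> insert k0 P"
      then show "\<exists>!i. i \<in> I \<and> G p i \<noteq> 0"
        by (rule insertE) (simp_all only: True GP[rule_format])
    qed
    then show ?thesis using X G by (intro exI[of _ X] exI[of _ G] conjI allI refl)
  next
    case False
    have "(\<Sum>i\<in>I. G k0 i * G k0 i) = 1"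
      using G k0 by (simp add: orthonormal_rows_def)
    then have "\<exists>i\<in>I. G k0 i \<noteq> 0"
      by (rule contrapos_pp) simp
    then obtain i j where ij: "i \<in> I" "j \<in> I" "i \<noteq> j" "G k0 i \<noteq> 0" "G k0 j \<noteq> 0"
      using False by blast
    define r where "r = sqrt ((G k0 i)\<^sup>2 + (G k0 j)\<^sup>2)"
    have r2: "r\<^sup>2 = (G k0 i)\<^sup>2 + (G k0 j)\<^sup>2" by (simp add: r_def)
    have r0: "r \<noteq> 0" using ij by (simp add: r_def sum_power2_eq_zero_iff)
    \<comment> \<open>This rotation sends the entries of row \<open>k0\<close> at \<open>i\<close>
      and \<open>j\<close> to \<open>r\<close> and \<open>0\<close>.\<close>
    define c d where "c = G k0 i / r" and "d = G k0 j / r"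
    have "c\<^sup>2 + d\<^sup>2 = ((G k0 i)\<^sup>2 + (G k0 j)\<^sup>2) / r\<^sup>2"
      by (simp add: c_def d_def power_divide add_divide_distrib)
    then have cd: "c\<^sup>2 + d\<^sup>2 = 1"
      unfolding r2[symmetric] using r0 by simp
    define X' where "X' = (\<lambda>k \<omega>. rotate_coords I i j c d (\<lambda>m. X m \<omega>) k)"
    define G' where "G' = (\<lambda>k. rotate_coords I i j c d (G k))"
    have X': "iid_normal M \<sigma> I X'"
      unfolding X'_def by (rule iid_normal_rotate[OF X fin ij(1-3) \<sigma> cd])
    have G': "orthonormal_rows I K G'"
      using G unfolding orthonormal_rows_def G'_def sum_rotate_coords[OF fin ij(1-3) cd] .
    have GX: "(\<Sum>i\<in>I. G' k i * X' i \<omega>) = (\<Sum>i\<in>I. G k i * X i \<omega>)" for k \<omega>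
      unfolding G'_def X'_def by (rule sum_rotate_coords[OF fin ij(1-3) cd])
    have G'P: "\<exists>!i. i \<in> I \<and> G' p i \<noteq> 0" if p: "p \<in> P" for p
    proof -
      obtain m where m: "m \<in> I" "G p m \<noteq> 0" and uniq: "\<And>i. i \<in> I \<Longrightarrow> G p i \<noteq> 0 \<Longrightarrow> i = m"
        using GP p by blast
      have "p \<noteq> k0" using uniq[OF ij(1)] uniq[OF ij(2)] ij(3-5) by auto
      then have "0 = (\<Sum>i\<in>I. G p i * G k0 i)"
        using G[unfolded orthonormal_rows_def, rule_format, of p k0] p P k0 by auto
      also have "\<dots> = (\<Sum>i\<in>I. if i = m then G p m * G k0 m else 0)"
      proof (intro sum.cong refl)
        fix i assume "i \<in> I"
        then show "G p i * G k0 i = (if i = m then G p m * G k0 m else 0)"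
          using uniq[of i] by (cases "i = m") auto
      qed
      also have "\<dots> = G p m * G k0 m" using m fin by simp
      \<comment> \<open>Orthogonality to a row that is already reduced, with its single entry at
        \<open>m\<close>, forces row \<open>k0\<close> to vanish there. So the rotation avoids
        column \<open>m\<close> and does not disturb row \<open>p\<close>.\<close>
      finally have "G k0 m = 0" using m by simp
      then have "m \<noteq> i" "m \<noteq> j" using ij by auto
      then have "G p i = 0" "G p j = 0" using uniq[OF ij(1)] uniq[OF ij(2)] by auto
      then have same: "G' p l = G p l" if "l \<in> I" for l
        using that by (simp add: G'_def rotate_coords_def)
      show ?thesis
      proof (rule ex1I[of _ m])
        show "m \<in> I \<and> G' p m \<noteq> 0" using m same[OF m(1)] by simp
        show "l = m" if "l \<in> I \<and> G' p l \<noteq> 0" for l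
          using that uniq[of l] same[of l] by simp
      qed
    qed
    have G'j: "G' k0 j = 0"
      using ij by (simp add: G'_def rotate_coords_def c_def d_def)
    have "G' k0 m = G k0 m" if "m \<in> I" "m \<noteq> i" "m \<noteq> j" for m
      using that by (simp add: G'_def rotate_coords_def)
    \<comment> \<open>No new nonzero entry appears: besides \<open>j\<close> only the entry at
      \<open>i\<close> changes, and it was nonzero before.\<close>
    then have "{m \<in> I. G' k0 m \<noteq> 0} \<subseteq> {m \<in> I. G k0 m \<noteq> 0} - {j}"
      using ij(4) G'j by force
    also have "\<dots> \<subset> {m \<in> I. G k0 m \<noteq> 0}" using ij by auto
    finally have "card {m \<in> I. G' k0 m \<noteq> 0} < card {m \<in> I. G k0 m \<noteq> 0}"
      using fin by (intro psubset_card_mono) auto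
    from less.hyps[OF this X' G' ballI[OF G'P]] show ?thesis unfolding GX .
  qed
qed

text \<open>Clearing the rows one after another leaves in row \<open>k\<close> a single entry, at
  \<open>f k\<close>. Norm one makes it 1 or -1 and orthogonality makes \<open>f\<close> injective,
  so the combinations are distinct coordinates up to sign.\<close>

theorem (in prob_space) iid_normal_orthonormal_rows:
  assumes fin: "finite I" "finite K" and "K \<noteq> {}" and \<sigma>: "\<sigma> > 0"
    and X: "iid_normal M \<sigma> I X" and G: "orthonormal_rows I K G"
  shows "iid_normal M \<sigma> K (\<lambda>k \<omega>. \<Sum>i\<in>I. G k i * X i \<omega>)"
proof -
  have "\<exists>X' G'. iid_normal M \<sigma> I X' \<and> orthonormal_rows I K G' \<and>
    (\<forall>k \<omega>. (\<Sum>i\<in>I. G' k i * X' i \<omega>) = (\<Sum>i\<in>I. G k i * X i \<omega>)) \<and>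
    (\<forall>p\<in>P. \<exists>!i. i \<in> I \<and> G' p i \<noteq> 0)" if "finite P" "P \<subseteq> K" for P
    using that
  proof (induction P rule: finite_induct)
    case empty
    then show ?case using X G by blast
  next
    case (insert p P)
    then have PK: "P \<subseteq> K" "p \<in> K" by auto
    from insert.IH[OF PK(1)] obtain X1 G1 where 1: "iid_normal M \<sigma> I X1" "orthonormal_rows I K G1"
      "\<forall>k \<omega>. (\<Sum>i\<in>I. G1 k i * X1 i \<omega>) = (\<Sum>i\<in>I. G k i * X i \<omega>)"
      "\<forall>p\<in>P. \<exists>!i. i \<in> I \<and> G1 p i \<noteq> 0"
      by (elim exE conjE) (rule that)
    show ?case
      using iid_normal_clear_row[OF fin(1) \<sigma> PK(2,1) 1(1,2,4)] unfolding 1(3)[rule_format] .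
  qed
  from this[OF fin(2) subset_refl] obtain X' G' where X': "iid_normal M \<sigma> I X'" and G': "orthonormal_rows I K G'"
    and eq: "\<forall>k \<omega>. (\<Sum>i\<in>I. G' k i * X' i \<omega>) = (\<Sum>i\<in>I. G k i * X i \<omega>)"
    and row: "\<forall>p\<in>K. \<exists>!i. i \<in> I \<and> G' p i \<noteq> 0"
    by (elim exE conjE) (rule that)
  note eq = eq[rule_format]
  from row obtain f where f: "\<And>k. k \<in> K \<Longrightarrow> f k \<in> I \<and> G' k (f k) \<noteq> 0"
    and uniq: "\<And>k i. k \<in> K \<Longrightarrow> i \<in> I \<Longrightarrow> G' k i \<noteq> 0 \<Longrightarrow> i = f k"
    by metis
  have single: "(\<Sum>i\<in>I. G' k i * x i) = G' k (f k) * x (f k)" if "k \<in> K" for k x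
  proof -
    have "(\<Sum>i\<in>I. G' k i * x i) = (\<Sum>i\<in>I. if i = f k then G' k (f k) * x (f k) else 0)"
      using uniq that by (intro sum.cong) auto
    then show ?thesis using f that fin by simp
  qed
  have inj: "inj_on f K"
  proof (rule inj_onI, rule ccontr)
    fix k l assume kl: "k \<in> K" "l \<in> K" "f k = f l" "k \<noteq> l"
    have "0 = (\<Sum>i\<in>I. G' k i * G' l i)" using G' kl by (simp add: orthonormal_rows_def)
    also have "\<dots> = G' k (f k) * G' l (f k)" using kl by (simp add: single)
    finally show False using f[OF kl(1)] f[OF kl(2)] kl(3) by simp
  qed
  have sgn: "\<bar>G' k (f k)\<bar> = 1" if "k \<in> K" for k
  proof -
    have "1 = (\<Sum>i\<in>I. G' k i * G' k i)" using G' that by (simp add: orthonormal_rows_def)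
    also have "\<dots> = (G' k (f k))\<^sup>2" using that by (simp add: single power2_eq_square)
    finally show ?thesis by (simp add: abs_square_eq_1)
  qed
  have "iid_normal M \<sigma> K (\<lambda>k. X' (f k))"
    using f by (intro iid_normal_reindex[OF X' inj _ \<sigma>]) auto
  then have ind: "indep_vars (\<lambda>_. borel) (\<lambda>k. X' (f k)) K"
    and norm: "\<And>k. k \<in> K \<Longrightarrow> distributed M lborel (X' (f k)) (normal_density 0 \<sigma>)"
    unfolding iid_normal_iff[OF \<open>K \<noteq> {}\<close> \<sigma>] by auto
  have "indep_vars (\<lambda>_. borel) (\<lambda>k \<omega>. G' k (f k) * X' (f k) \<omega>) K"
    by (rule indep_vars_compose2[OF ind]) simp
  \<comment> \<open>A factor of absolute value one leaves both the mean \<open>0\<close> and the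
    deviation \<open>\<sigma>\<close> unchanged.\<close>
  moreover have "distributed M lborel (\<lambda>\<omega>. G' k (f k) * X' (f k) \<omega>) (normal_density 0 \<sigma>)"
    if "k \<in> K" for k
    using normal_density_affine[OF norm[OF that] \<sigma>, of "G' k (f k)" 0] f[OF that] sgn[OF that]
    by simp
  ultimately have "iid_normal M \<sigma> K (\<lambda>k \<omega>. G' k (f k) * X' (f k) \<omega>)"
    unfolding iid_normal_iff[OF \<open>K \<noteq> {}\<close> \<sigma>] by auto
  then show ?thesis
    unfolding iid_normal_def eq[symmetric]
    by (simp add: single cong: restrict_cong)
qed

subsection \<open>Least squares residuals\<close>

text \<open>Shifting the parameters by \<open>x\<close> and \<open>z\<close> changes the sum of
  squares by a quadratic without cross term, thanks to the normalization of \<open>t\<close>.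
  Minimality makes this quadratic nonnegative, so two test shifts replace differentiation.\<close>

lemma least_squares_normal_equations:
  fixes t y :: "nat \<Rightarrow> real"
  assumes n: "n \<ge> 1" and t1: "(\<Sum>j=1..n. t j) = 0" and t2: "(\<Sum>j=1..n. (t j)\<^sup>2) = 1"
    and ls: "is_least_squares n t y u v"
  shows "(\<Sum>j=1..n. y j - u - v * t j) = 0" "(\<Sum>j=1..n. t j * (y j - u - v * t j)) = 0"
proof -
  define r where "r j = y j - u - v * t j" for j
  define S T where "S = (\<Sum>j=1..n. r j)" and "T = (\<Sum>j=1..n. t j * r j)"
  have minimal: "sum_sq_dev n t y u v \<le> sum_sq_dev n t y u' v'" for u' v'
    using ls unfolding is_least_squares_def is_arg_min_def by (auto simp: not_less)
  have le: "(\<Sum>j=1..n. (r j)\<^sup>2) \<le> (\<Sum>j=1..n. (r j - x - z * t j)\<^sup>2)" for x z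
    using minimal[of "u + x" "v + z"] by (simp add: sum_sq_dev_def r_def algebra_simps)
  have expand: "(\<Sum>j=1..n. (r j - x - z * t j)\<^sup>2) =
      (\<Sum>j=1..n. (r j)\<^sup>2) - 2 * x * S - 2 * z * T + real n * x\<^sup>2 + z\<^sup>2" for x z
  proof -
    have "(\<Sum>j=1..n. (r j - x - z * t j)\<^sup>2) =
      (\<Sum>j=1..n. (r j)\<^sup>2 - 2 * x * r j - 2 * z * (t j * r j) + x\<^sup>2 + z\<^sup>2 * (t j)\<^sup>2 + 2 * x * z * t j)"
      by (intro sum.cong) (simp_all add: power2_eq_square algebra_simps)
    also have "\<dots> = (\<Sum>j=1..n. (r j)\<^sup>2) - 2 * x * S - 2 * z * T + real n * x\<^sup>2 +
        z\<^sup>2 * (\<Sum>j=1..n. (t j)\<^sup>2) + 2 * x * z * (\<Sum>j=1..n. t j)"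
      unfolding S_def T_def sum_distrib_left
      by (simp only: sum.distrib sum_subtractf) (simp add: sum_distrib_left)
    finally show ?thesis using t1 t2 by simp
  qed
  have ge: "0 \<le> - 2 * x * S - 2 * z * T + real n * x\<^sup>2 + z\<^sup>2" for x z
    using le[of x z] expand[of x z] by linarith
  \<comment> \<open>The shifts \<open>x = S / n\<close> and, further below, \<open>z = T\<close>
    minimize the quadratic in one variable; its values there are -S^2 / n and -T^2.\<close>
  have "S\<^sup>2 / n \<le> 0"
    using ge[of "S / n" 0] n by (simp add: power2_eq_square field_simps)
  then have "S\<^sup>2 \<le> 0"
    using n by (simp add: divide_le_0_iff)
  then show "(\<Sum>j=1..n. y j - u - v * t j) = 0"
    by (simp add: S_def r_def)
  have "T\<^sup>2 \<le> 0"
    using ge[of 0 T] by (simp add: power2_eq_square)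
  then show "(\<Sum>j=1..n. t j * (y j - u - v * t j)) = 0"
    by (simp add: T_def r_def)
qed

text \<open>The matrix I - 1 1'/n - t t', a projection because 1 / sqrt n and \<open>t\<close> are
  orthonormal.\<close>

definition residual_proj :: "nat \<Rightarrow> (nat \<Rightarrow> real) \<Rightarrow> nat \<Rightarrow> nat \<Rightarrow> real" where
  "residual_proj n t i k = (if i = k then 1 else 0) - 1 / real n - t i * t k"

lemma sum_residual_proj:
  assumes i: "i \<in> {1..n}"
  shows "(\<Sum>k=1..n. residual_proj n t i k * x k) =
    x i - (\<Sum>k=1..n. x k) / n - t i * (\<Sum>k=1..n. t k * x k)"
proof -
  have "(\<Sum>k=1..n. residual_proj n t i k * x k) =
      (\<Sum>k=1..n. (if i = k then x k else 0) - x k / n - t i * (t k * x k))"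
    by (intro sum.cong) (simp_all add: residual_proj_def algebra_simps)
  then show ?thesis
    using i by (simp add: sum_subtractf sum_distrib_left sum_divide_distrib)
qed

text \<open>The rows of the projection are orthogonal to 1 and \<open>t\<close>, so applying it to
  one of its own rows changes nothing; the symmetry of the matrix then gives the claim.\<close>

lemma residual_proj_idem:
  assumes "n \<ge> 1" "(\<Sum>j=1..n. t j) = 0" "(\<Sum>j=1..n. (t j)\<^sup>2) = 1" and i: "i \<in> {1..n}" "l \<in> {1..n}"
  shows "(\<Sum>k=1..n. residual_proj n t i k * residual_proj n t l k) = residual_proj n t i l"
proof -
  have swap: "residual_proj n t l k = residual_proj n t k l" for k
    by (simp add: residual_proj_def)
  have "(\<Sum>k=1..n. residual_proj n t l k) = 0"
    using sum_residual_proj[OF i(2), of t "\<lambda>_. 1"] assms(1,2) by simp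
  moreover have "(\<Sum>k=1..n. residual_proj n t l k * t k) = 0"
    using sum_residual_proj[OF i(2), of t t] assms(2,3) by (simp add: power2_eq_square)
  ultimately show ?thesis
    using sum_residual_proj[OF i(1), of t "residual_proj n t l"]
    by (simp add: mult.commute swap[of i])
qed

text \<open>By the normal equations the noise has mean \<open>u - a\<close> and component
  \<open>v - b\<close> along \<open>t\<close>. Removing both turns the true parameters into the
  fitted ones.\<close>

lemma residual_eq_residual_proj:
  fixes t y :: "nat \<Rightarrow> real"
  assumes n: "n \<ge> 1" and t1: "(\<Sum>j=1..n. t j) = 0" and t2: "(\<Sum>j=1..n. (t j)\<^sup>2) = 1"
    and ls: "is_least_squares n t y u v" and j: "j \<in> {1..n}"
  shows "y j - u - v * t j = (\<Sum>k=1..n. residual_proj n t j k * (y k - a - b * t k))"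
proof -
  note eq = least_squares_normal_equations[OF n t1 t2 ls]
  have "(\<Sum>k=1..n. y k - a - b * t k) = (\<Sum>k=1..n. (y k - u - v * t k) + (u - a) + (v - b) * t k)"
    by (intro sum.cong) (simp_all add: algebra_simps)
  also have "\<dots> = (\<Sum>k=1..n. y k - u - v * t k) + n * (u - a) + (v - b) * (\<Sum>k=1..n. t k)"
    by (simp only: sum.distrib) (simp add: sum_distrib_left)
  finally have 1: "(\<Sum>k=1..n. y k - a - b * t k) = n * (u - a)"
    using eq t1 by simp
  have "(\<Sum>k=1..n. t k * (y k - a - b * t k)) =
      (\<Sum>k=1..n. t k * (y k - u - v * t k) + (u - a) * t k + (v - b) * (t k)\<^sup>2)"
    by (intro sum.cong) (simp_all add: algebra_simps power2_eq_square)
  also have "\<dots> = (\<Sum>k=1..n. t k * (y k - u - v * t k)) + (u - a) * (\<Sum>k=1..n. t k) +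
      (v - b) * (\<Sum>k=1..n. (t k)\<^sup>2)"
    by (simp only: sum.distrib) (simp add: sum_distrib_left)
  finally have 2: "(\<Sum>k=1..n. t k * (y k - a - b * t k)) = v - b"
    using eq t1 t2 by simp
  have "n * (u - a) / n = u - a" using n by simp
  then show ?thesis
    unfolding sum_residual_proj[OF j] 1 2 by (simp add: algebra_simps)
qed

lemma sum_split_first_two:
  fixes f :: "nat \<Rightarrow> 'a :: comm_monoid_add"
  assumes "n \<ge> 2"
  shows "(\<Sum>j=1..n. f j) = f 1 + f 2 + (\<Sum>j=3..n. f j)"
proof -
  have "{1..n} = insert 1 (insert 2 {3..n})" using assms by auto
  then show ?thesis by (simp add: add.assoc)
qed

lemma sum_shift_two:
  fixes n :: nat
  shows "n \<ge> 2 \<Longrightarrow> (\<Sum>j=1..n-2. f (j + 2)) = (\<Sum>j=3..n. f j)"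
  by (rule sum.reindex_bij_witness[of _ "\<lambda>j. j - 2" "\<lambda>j. j + 2"]) auto

section \<open>Algebraic identities for the two choices of coefficients\<close>

lemma mat2_eq_iff [simp]:
  "mat2 p q r s = mat2 p' q' r' s' \<longleftrightarrow> p = p' \<and> q = q' \<and> r = r' \<and> s = s'"
  by (auto simp: mat2_def vec_eq_iff forall_2)

lemma scaleR_mat2 [simp]: "c *\<^sub>R mat2 p q r s = mat2 (c * p) (c * q) (c * r) (c * s)"
  by (simp add: mat2_def vec_eq_iff forall_2)

text \<open>Here \<open>[A, B; C, D]\<close> is the inverse of \<open>diag(e N, e') - [1, t1; 1, t2]\<close>. The first two
  identities say that it is a left inverse, the last two that it is a right inverse.\<close>

lemma cramer_identities:
  fixes e e' N t1 t2 :: real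
  defines "d \<equiv> (e * N - 1) * (e' - t2) - t1"
  assumes d: "d \<noteq> 0"
    and ABCD: "A = (e' - t2) / d" "B = t1 / d" "C = 1 / d" "D = (e * N - 1) / d"
  shows "1 + (A + C * \<tau>) + (B + D * \<tau>) = e * N * (A + C * \<tau>)"
    and "\<tau> + (A + C * \<tau>) * t1 + (B + D * \<tau>) * t2 = e' * (B + D * \<tau>)"
    and "x + (A * x + B * y) + (C * x + D * y) * t1 = e * N * (A * x + B * y)"
    and "y + (A * x + B * y) + (C * x + D * y) * t2 = e' * (C * x + D * y)"
proof -
  \<comment> \<open>The goals are affine in \<open>\<tau>\<close> or linear in \<open>x\<close> and
    \<open>y\<close>, so it suffices to compare coefficients; each follows by clearing the
    denominator \<open>d\<close>.\<close>
  have right: "1 + A + B = e * N * A" "C + D = e * N * C"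
      "A * t1 + B * t2 = e' * B" "1 + C * t1 + D * t2 = e' * D"
    and left: "1 + A + C * t1 = e * N * A" "B + D * t1 = e * N * B"
      "A + C * t2 = e' * C" "1 + B + D * t2 = e' * D"
    unfolding ABCD using d by (simp_all add: divide_simps) (simp_all add: d_def algebra_simps)
  have "1 + (A + C * \<tau>) + (B + D * \<tau>) = (1 + A + B) + (C + D) * \<tau>"
    by (simp add: algebra_simps)
  then show "1 + (A + C * \<tau>) + (B + D * \<tau>) = e * N * (A + C * \<tau>)"
    unfolding right by (simp add: algebra_simps)
  have "\<tau> + (A + C * \<tau>) * t1 + (B + D * \<tau>) * t2 = (A * t1 + B * t2) + (1 + C * t1 + D * t2) * \<tau>"
    by (simp add: algebra_simps)
  then show "\<tau> + (A + C * \<tau>) * t1 + (B + D * \<tau>) * t2 = e' * (B + D * \<tau>)"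
    unfolding right by (simp add: algebra_simps)
  have "x + (A * x + B * y) + (C * x + D * y) * t1 = (1 + A + C * t1) * x + (B + D * t1) * y"
    by (simp add: algebra_simps)
  then show "x + (A * x + B * y) + (C * x + D * y) * t1 = e * N * (A * x + B * y)"
    unfolding left by (simp add: algebra_simps)
  have "y + (A * x + B * y) + (C * x + D * y) * t2 = (A + C * t2) * x + (1 + B + D * t2) * y"
    by (simp add: algebra_simps)
  then show "y + (A * x + B * y) + (C * x + D * y) * t2 = e' * (C * x + D * y)"
    unfolding left by (simp add: algebra_simps)
qed

text \<open>The condition \<open>k (1 - t 2) = t 1\<close> forces equality in the Cauchy--Schwarz inequality for
  \<open>t 3, \<dots>, t n\<close>, so that these entries coincide and the first two residuals become
  proportional.\<close>

lemma degenerate_design: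
  fixes t :: "nat \<Rightarrow> real"
  assumes n: "n \<ge> 3" and t1: "(\<Sum>j=1..n. t j) = 0" and t2: "(\<Sum>j=1..n. (t j)\<^sup>2) = 1"
    and k: "k = sqrt (real n) - 1" and deg: "k * (1 - t 2) = t 1"
    and s: "s = 1 / (k * (k + 1))"
  shows "t 1 = k * s" "t 2 = 1 - s" "\<And>j. j \<in> {3..n} \<Longrightarrow> t j = - s"
proof -
  \<comment> \<open>A single unknown remains: \<open>t 1 = k * x\<close> and
    \<open>t 2 = 1 - x\<close>, so the first two moments of the tail are polynomials in
    \<open>x\<close>.\<close>
  define x where "x = 1 - t 2"
  have k0: "k > 0" using n k by simp
  have "(k + 1)\<^sup>2 = real n" using k by simp
  then have nk: "real n = k\<^sup>2 + 2 * k + 1" by (simp add: power2_eq_square algebra_simps)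
  have "s * (k * (k + 1)) = 1" using k0 s by simp
  then have ks: "k * k * s + k * s = 1" by (simp add: algebra_simps)
  have card: "real (n - 2) = k\<^sup>2 + 2 * k - 1" using n nk by (simp add: of_nat_diff)
  have "(\<Sum>j=3..n. (t j + s)\<^sup>2) = (\<Sum>j=3..n. (t j)\<^sup>2) + 2 * s * (\<Sum>j=3..n. t j) + (k\<^sup>2 + 2 * k - 1) * s\<^sup>2"
    by (simp add: power2_sum sum.distrib sum_distrib_left card ac_simps)
  also have "(\<Sum>j=3..n. (t j)\<^sup>2) = 1 - (k * x)\<^sup>2 - (1 - x)\<^sup>2"
    using t2 sum_split_first_two[of n "\<lambda>j. (t j)\<^sup>2"] n deg by (simp add: x_def)
  also have "(\<Sum>j=3..n. t j) = - (k * x + (1 - x))"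
    using t1 sum_split_first_two[of n t] n deg by (simp add: x_def)
  \<comment> \<open>The value of \<open>s\<close> is the one for which the term linear in
    \<open>x - s\<close> drops out. A sum of squares then equals minus a square, so both
    vanish.\<close>
  also have "1 - (k * x)\<^sup>2 - (1 - x)\<^sup>2 + 2 * s * - (k * x + (1 - x)) + (k\<^sup>2 + 2 * k - 1) * s\<^sup>2 =
      - (k\<^sup>2 + 1) * (x - s)\<^sup>2 + 2 * (x - s) * (1 - (k * k * s + k * s))"
    by (simp add: power2_eq_square algebra_simps)
  also have "\<dots> = - (k\<^sup>2 + 1) * (x - s)\<^sup>2"
    unfolding ks by simp
  finally have sq: "(\<Sum>j=3..n. (t j + s)\<^sup>2) + (k\<^sup>2 + 1) * (x - s)\<^sup>2 = 0"
    by (simp add: algebra_simps)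
  have nonneg: "(\<Sum>j=3..n. (t j + s)\<^sup>2) \<ge> 0" "(k\<^sup>2 + 1) * (x - s)\<^sup>2 \<ge> 0"
    by (simp_all add: sum_nonneg)
  have "(k\<^sup>2 + 1) * (x - s)\<^sup>2 = 0" and zero: "(\<Sum>j=3..n. (t j + s)\<^sup>2) = 0"
    using sq nonneg by linarith+
  moreover have "k\<^sup>2 + 1 \<noteq> 0" using zero_le_power2[of k] by linarith
  ultimately have "x = s" by simp
  then show "t 1 = k * s" "t 2 = 1 - s" using deg by (auto simp: x_def)
  show "t j = - s" if "j \<in> {3..n}" for j
    using zero that by (auto simp: sum_nonneg_eq_0_iff add_eq_0_iff2)
qed

text \<open>Common interface to all cases: the signs \<open>(e, e')\<close> are
  \<open>(1, 1)\<close> in case (a) and \<open>(- 1, - s)\<close> in case (b). The first two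
  identities feed orthonormality, the last two the sum of squares. The latter are stated for vectors
  satisfying the normal equations because the degenerate case uses those equations.\<close>

lemma coeffs_identities:
  fixes t :: "nat \<Rightarrow> real"
  assumes n: "n \<ge> 3" and t1: "(\<Sum>j=1..n. t j) = 0" and t2: "(\<Sum>j=1..n. (t j)\<^sup>2) = 1"
    and coeffs: "mat2 A B C D = coeffs_a n (t 1) (t 2) \<or>
         (\<exists>s. is_sign ((sqrt (real n) + 1) * t 2 - t 1) s \<and>
              mat2 A B C D = coeffs_b n (t 1) (t 2) s)"
  obtains e e' where "e\<^sup>2 = 1" "e'\<^sup>2 = 1"
    and "\<And>j. j \<in> {3..n} \<Longrightarrow> 1 + (A + C * t j) + (B + D * t j) = e * sqrt n * (A + C * t j)"
    and "\<And>j. j \<in> {3..n} \<Longrightarrow>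
      t j + (A + C * t j) * t 1 + (B + D * t j) * t 2 = e' * (B + D * t j)"
    and "\<And>r :: nat \<Rightarrow> real. (\<Sum>j=1..n. r j) = 0 \<Longrightarrow> (\<Sum>j=1..n. t j * r j) = 0 \<Longrightarrow>
      r 1 + (A * r 1 + B * r 2) + (C * r 1 + D * r 2) * t 1 = e * sqrt n * (A * r 1 + B * r 2)"
    and "\<And>r :: nat \<Rightarrow> real. (\<Sum>j=1..n. r j) = 0 \<Longrightarrow> (\<Sum>j=1..n. t j * r j) = 0 \<Longrightarrow>
      r 2 + (A * r 1 + B * r 2) + (C * r 1 + D * r 2) * t 2 = e' * (C * r 1 + D * r 2)"
proof -
  consider (regular) "(sqrt n - 1) * (1 - t 2) - t 1 \<noteq> 0" "mat2 A B C D = coeffs_a n (t 1) (t 2)"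
    | (degenerate) "(sqrt n - 1) * (1 - t 2) = t 1" "mat2 A B C D = coeffs_a n (t 1) (t 2)"
    | (b) s where "is_sign ((sqrt n + 1) * t 2 - t 1) s" "mat2 A B C D = coeffs_b n (t 1) (t 2) s"
    using coeffs by (cases "(sqrt n - 1) * (1 - t 2) - t 1 = 0") auto
  then show thesis
  proof cases
    case regular
    let ?d = "(1 * sqrt n - 1) * (1 - t 2) - t 1"
    have "?d \<noteq> 0" "A = (1 - t 2) / ?d" "B = t 1 / ?d" "C = 1 / ?d" "D = (1 * sqrt n - 1) / ?d"
      using regular by (simp_all add: coeffs_a_def Let_def)
    note cramer_identities[OF this]
    then show thesis by (intro that[of 1 1]) simp_all
  next
    case b
    let ?y = "(sqrt n + 1) * t 2 - t 1"
    \<comment> \<open>The sign \<open>s\<close> prevents cancellation: this denominator is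
      \<open>s\<close> times a positive number, even when \<open>?y = 0\<close> and whichever sign
      is chosen there.\<close>
    let ?d = "(- 1 * sqrt n - 1) * (- s - t 2) - t 1"
    have s: "s * s = 1" "s * ?y = \<bar>?y\<bar>" and s2: "s\<^sup>2 = 1"
      using b(1) by (auto simp: is_sign_def abs_if)
    have "?d = s * (sqrt n + 1) + (s * s) * ?y"
      unfolding s(1) by (simp add: algebra_simps)
    also have "\<dots> = s * ((sqrt n + 1) + \<bar>?y\<bar>)"
      unfolding s(2)[symmetric] by (simp only: distrib_left mult.assoc)
    finally have d: "?d = s * ((sqrt n + 1) + \<bar>?y\<bar>)" .
    have pos: "(sqrt n + 1) + \<bar>?y\<bar> > 0" by (smt (verit) real_sqrt_ge_zero of_nat_0_le_iff)
    have d0: "?d \<noteq> 0" using d pos s by auto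
    have "- s / P = - 1 / (s * P)" for P :: real
      using b(1) by (auto simp: is_sign_def)
    then have inv: "- s / ((sqrt n + 1) + \<bar>?y\<bar>) = - 1 / ?d"
      unfolding d .
    have "A = (- s - t 2) / ?d" "B = t 1 / ?d" "C = 1 / ?d" "D = (- 1 * sqrt n - 1) / ?d"
      using b(2) unfolding coeffs_b_def inv by (simp_all add: diff_divide_distrib add_divide_distrib)
    note cramer_identities[OF d0 this]
    then show thesis using s2 by (intro that[of "- 1" "- s"]) simp_all
  next
    case degenerate
    define k where "k = sqrt n - 1"
    define s where "s = 1 / (k * (k + 1))"
    have k0: "k > 0" using n by (simp add: k_def)
    have N: "sqrt n = k + 1" by (simp add: k_def)
    have ABCD: "A = 1 / k" "B = 0" "C = 0" "D = 0"
      using degenerate by (simp_all add: coeffs_a_def Let_def k_def)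
    note des = degenerate_design[OF n t1 t2 k_def degenerate(1)[folded k_def] s_def]
    \<comment> \<open>Since \<open>t\<close> is constant on \<open>{3..n}\<close>, the second normal
      equation sees the tail of \<open>r\<close> only through its sum, which the first one expresses
      by \<open>r 1 + r 2\<close>.\<close>
    have rel: "r 2 + r 1 / k = 0"
      if r: "(\<Sum>j=1..n. r j) = 0" "(\<Sum>j=1..n. t j * r j) = 0" for r :: "nat \<Rightarrow> real"
    proof -
      have "(\<Sum>j=3..n. t j * r j) = - s * (\<Sum>j=3..n. r j)"
        unfolding sum_distrib_left by (intro sum.cong) (simp_all add: des)
      moreover have "(\<Sum>j=3..n. r j) = - (r 1 + r 2)"
        using r(1) n sum_split_first_two[of n r] by linarith
      ultimately have "t 1 * r 1 + t 2 * r 2 + s * (r 1 + r 2) = 0"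
        using r(2) n sum_split_first_two[of n "\<lambda>j. t j * r j"]
        by (simp add: algebra_simps)
      then have "(k * s + s) * r 1 + r 2 = 0"
        unfolding des by (simp add: algebra_simps)
      moreover have "k * s + s = 1 / k"
      proof -
        have "s * (k + 1) = 1 / k" using k0 by (simp add: s_def)
        then show ?thesis by (simp add: algebra_simps)
      qed
      ultimately show ?thesis by simp
    qed
    show thesis
    proof (rule that[of 1 1])
      fix r :: "nat \<Rightarrow> real" assume r: "(\<Sum>j=1..n. r j) = 0" "(\<Sum>j=1..n. t j * r j) = 0"
      show "r 1 + (A * r 1 + B * r 2) + (C * r 1 + D * r 2) * t 1 = 1 * sqrt n * (A * r 1 + B * r 2)"
        unfolding ABCD N using k0 by (simp add: field_simps)
      show "r 2 + (A * r 1 + B * r 2) + (C * r 1 + D * r 2) * t 2 = 1 * (C * r 1 + D * r 2)"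
        unfolding ABCD using rel[OF r] by simp
    next
      fix j assume j: "j \<in> {3..n}"
      show "1 + (A + C * t j) + (B + D * t j) = 1 * sqrt n * (A + C * t j)"
        unfolding ABCD N using k0 by (simp add: field_simps)
      show "t j + (A + C * t j) * t 1 + (B + D * t j) * t 2 = 1 * (B + D * t j)"
        unfolding ABCD des(1) des(3)[OF j] using k0 by simp
    qed simp_all
  qed
qed

section \<open>Orthonormality and preservation of the sum of squares\<close>

text \<open>Each row is the projection of a vector with entry 1 at \<open>j\<close> and entries
  \<open>\<alpha> j\<close>, \<open>\<beta> j\<close> at 1, 2. The inner product of two such vectors
  exceeds the desired value by \<open>\<alpha> j * \<alpha> l + \<beta> j * \<beta> l\<close>; the
  parts along 1 and \<open>t\<close> that the projection removes are exactly these two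
  products.\<close>

lemma orthonormal_residual_transform:
  fixes t \<alpha> \<beta> :: "nat \<Rightarrow> real"
  assumes n: "n \<ge> 3" and t1: "(\<Sum>j=1..n. t j) = 0" and t2: "(\<Sum>j=1..n. (t j)\<^sup>2) = 1"
    and e: "e\<^sup>2 = 1" "e'\<^sup>2 = 1"
    and \<alpha>: "\<And>j. j \<in> {3..n} \<Longrightarrow> 1 + \<alpha> j + \<beta> j = e * sqrt n * \<alpha> j"
    and \<beta>: "\<And>j. j \<in> {3..n} \<Longrightarrow> t j + \<alpha> j * t 1 + \<beta> j * t 2 = e' * \<beta> j"
  shows "orthonormal_rows {1..n} {3..n}
    (\<lambda>j k. residual_proj n t j k + \<alpha> j * residual_proj n t 1 k + \<beta> j * residual_proj n t 2 k)"
  unfolding orthonormal_rows_def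
proof (intro ballI)
  fix j l assume jl: "j \<in> {3..n}" "l \<in> {3..n}"
  let ?P = "residual_proj n t"
  have idem: "(\<Sum>k=1..n. ?P i k * ?P m k) = ?P i m" if "i \<in> {1..n}" "m \<in> {1..n}" for i m
    using n by (intro residual_proj_idem[OF _ t1 t2 that]) simp
  have mem: "j \<in> {1..n}" "l \<in> {1..n}" "1 \<in> {1..n}" "2 \<in> {1..n}" using jl n by auto
  have "(\<Sum>k=1..n. (?P j k + \<alpha> j * ?P 1 k + \<beta> j * ?P 2 k) * (?P l k + \<alpha> l * ?P 1 k + \<beta> l * ?P 2 k)) =
    (\<Sum>k=1..n. ?P j k * ?P l k + \<alpha> l * (?P j k * ?P 1 k) + \<beta> l * (?P j k * ?P 2 k) +
      \<alpha> j * (?P 1 k * ?P l k) + \<alpha> j * \<alpha> l * (?P 1 k * ?P 1 k) + \<alpha> j * \<beta> l * (?P 1 k * ?P 2 k) +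
      \<beta> j * (?P 2 k * ?P l k) + \<beta> j * \<alpha> l * (?P 2 k * ?P 1 k) + \<beta> j * \<beta> l * (?P 2 k * ?P 2 k))"
    by (intro sum.cong) (simp_all add: algebra_simps)
  also have "\<dots> = ?P j l + \<alpha> l * ?P j 1 + \<beta> l * ?P j 2 + \<alpha> j * ?P 1 l + \<alpha> j * \<alpha> l * ?P 1 1 +
      \<alpha> j * \<beta> l * ?P 1 2 + \<beta> j * ?P 2 l + \<beta> j * \<alpha> l * ?P 2 1 + \<beta> j * \<beta> l * ?P 2 2"
    by (simp only: sum.distrib sum_distrib_left[symmetric] idem mem)
  also have "\<dots> = (if j = l then 1 else 0) + \<alpha> j * \<alpha> l + \<beta> j * \<beta> l -
      (1 + \<alpha> j + \<beta> j) * (1 + \<alpha> l + \<beta> l) / n -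
      (t j + \<alpha> j * t 1 + \<beta> j * t 2) * (t l + \<alpha> l * t 1 + \<beta> l * t 2)"
    using jl by (simp add: residual_proj_def algebra_simps add_divide_distrib)
  also have "(1 + \<alpha> j + \<beta> j) * (1 + \<alpha> l + \<beta> l) / n = e\<^sup>2 * ((sqrt n)\<^sup>2 / n) * (\<alpha> j * \<alpha> l)"
    unfolding \<alpha>[OF jl(1)] \<alpha>[OF jl(2)] by (simp only: power2_eq_square) (simp add: ac_simps)
  also have "\<dots> = \<alpha> j * \<alpha> l" using e n by simp
  also have "(t j + \<alpha> j * t 1 + \<beta> j * t 2) * (t l + \<alpha> l * t 1 + \<beta> l * t 2) = e'\<^sup>2 * (\<beta> j * \<beta> l)"
    unfolding \<beta>[OF jl(1)] \<beta>[OF jl(2)] by (simp only: power2_eq_square) (simp add: ac_simps)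
  finally show "(\<Sum>k=1..n. (?P j k + \<alpha> j * ?P 1 k + \<beta> j * ?P 2 k) *
      (?P l k + \<alpha> l * ?P 1 k + \<beta> l * ?P 2 k)) = (if j = l then 1 else 0)"
    using e by simp
qed

text \<open>Extend the transformed vector to all indices \<open>1..n\<close>. As \<open>r\<close>, 1
  and \<open>t\<close> are pairwise orthogonal, Pythagoras adds n p^2 + q^2 to the sum of squares of
  \<open>r\<close>; the entries at 1 and 2 have squares n p^2 and q^2, so dropping them restores the
  sum.\<close>

lemma sum_squares_transformed:
  fixes t r :: "nat \<Rightarrow> real"
  assumes n: "n \<ge> 3" and t1: "(\<Sum>j=1..n. t j) = 0" and t2: "(\<Sum>j=1..n. (t j)\<^sup>2) = 1"
    and r: "(\<Sum>j=1..n. r j) = 0" "(\<Sum>j=1..n. t j * r j) = 0"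
    and e: "e\<^sup>2 = 1" "e'\<^sup>2 = 1"
    and p: "r 1 + p + q * t 1 = e * sqrt n * p" and q: "r 2 + p + q * t 2 = e' * q"
  shows "(\<Sum>j=1..n-2. (r (j + 2) + p + q * t (j + 2))\<^sup>2) = (\<Sum>j=1..n. (r j)\<^sup>2)"
proof -
  have "(\<Sum>j=1..n. (r j + p + q * t j)\<^sup>2) =
      (\<Sum>j=1..n. (r j)\<^sup>2 + p\<^sup>2 + q\<^sup>2 * (t j)\<^sup>2 + 2 * p * r j + 2 * q * (t j * r j) + 2 * p * q * t j)"
    by (intro sum.cong) (simp_all add: power2_eq_square algebra_simps)
  also have "\<dots> = (\<Sum>j=1..n. (r j)\<^sup>2) + n * p\<^sup>2 + q\<^sup>2"
    using t1 t2 r by (simp only: sum.distrib sum_distrib_left[symmetric]) simp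
  also have "n * p\<^sup>2 = (r 1 + p + q * t 1)\<^sup>2"
    unfolding p using e by (simp add: power_mult_distrib)
  also have "q\<^sup>2 = (r 2 + p + q * t 2)\<^sup>2"
    unfolding q using e by (simp add: power_mult_distrib)
  finally show ?thesis
    using n sum_split_first_two[of n "\<lambda>j. (r j + p + q * t j)\<^sup>2"]
      sum_shift_two[of n "\<lambda>j. (r j + p + q * t j)\<^sup>2"] by simp
qed

section \<open>Joint law of the transformed residuals\<close>

theorem corollary5:
  fixes M :: "'w measure" and n :: nat and t :: "nat \<Rightarrow> real" and a b \<sigma> :: real
    and Y R W :: "nat \<Rightarrow> 'w \<Rightarrow> real" and ahat bhat :: "'w \<Rightarrow> real" and A B C D :: real
  assumes "prob_space M"
    and "n \<ge> 3"
    and "(\<Sum>j=1..n. t j) = 0"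
    and "(\<Sum>j=1..n. (t j)\<^sup>2) = 1"
    and "\<sigma> > 0"
    and "prob_space.indep_vars M (\<lambda>_. borel) Y {1..n}"
    and "\<And>j. j \<in> {1..n} \<Longrightarrow>
           distributed M lborel (\<lambda>\<omega>. Y j \<omega> - a - b * t j) (normal_density 0 \<sigma>)"
    and "\<And>\<omega>. \<omega> \<in> space M \<Longrightarrow> is_least_squares n t (\<lambda>j. Y j \<omega>) (ahat \<omega>) (bhat \<omega>)"
    and "R = residual t Y ahat bhat"
    and "W = transformed_residual t A B C D R"
    and "mat2 A B C D = coeffs_a n (t 1) (t 2) \<or>
         (\<exists>s. is_sign ((sqrt (real n) + 1) * t 2 - t 1) s \<and>
              mat2 A B C D = coeffs_b n (t 1) (t 2) s)"
  shows "prob_space.indep_vars M (\<lambda>_. borel) W {1..n-2} \<and>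
    (\<forall>j\<in>{1..n-2}. distributed M lborel (W j) (normal_density 0 \<sigma>)) \<and>
    (\<forall>\<omega>\<in>space M. (\<Sum>j=1..n-2. (W j \<omega>)\<^sup>2) = (\<Sum>j=1..n. (R j \<omega>)\<^sup>2))"
proof -
  interpret prob_space M by fact
  note n = assms(2) and t1 = assms(3) and t2 = assms(4) and \<sigma> = assms(5) and ls = assms(8)
  have n1: "n \<ge> 1" using n by simp
  obtain e e' where e: "e\<^sup>2 = 1" "e'\<^sup>2 = 1"
    and \<alpha>: "\<And>j. j \<in> {3..n} \<Longrightarrow> 1 + (A + C * t j) + (B + D * t j) = e * sqrt n * (A + C * t j)"
    and \<beta>: "\<And>j. j \<in> {3..n} \<Longrightarrow>
      t j + (A + C * t j) * t 1 + (B + D * t j) * t 2 = e' * (B + D * t j)"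
    and p: "\<And>r :: nat \<Rightarrow> real. (\<Sum>j=1..n. r j) = 0 \<Longrightarrow> (\<Sum>j=1..n. t j * r j) = 0 \<Longrightarrow>
      r 1 + (A * r 1 + B * r 2) + (C * r 1 + D * r 2) * t 1 = e * sqrt n * (A * r 1 + B * r 2)"
    and q: "\<And>r :: nat \<Rightarrow> real. (\<Sum>j=1..n. r j) = 0 \<Longrightarrow> (\<Sum>j=1..n. t j * r j) = 0 \<Longrightarrow>
      r 2 + (A * r 1 + B * r 2) + (C * r 1 + D * r 2) * t 2 = e' * (C * r 1 + D * r 2)"
    by (rule coeffs_identities[OF n t1 t2 assms(11)]) (rule that; blast)
  define \<epsilon> where "\<epsilon> = (\<lambda>j \<omega>. Y j \<omega> - a - b * t j)"
  \<comment> \<open>Regrouping the definition of \<open>W\<close> gives \<open>R 1\<close> the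
    coefficient \<open>A + C * t j\<close> and \<open>R 2\<close> the coefficient
    \<open>B + D * t j\<close>. Rows are indexed by \<open>{3..n}\<close>, so \<open>W j\<close>
    belongs to row \<open>j + 2\<close>.\<close>
  define G where "G = (\<lambda>j k. residual_proj n t j k + (A + C * t j) * residual_proj n t 1 k +
    (B + D * t j) * residual_proj n t 2 k)"
  have K: "{3..n} \<noteq> {}" "{1..n} \<noteq> {}" "{1..n-2} \<noteq> {}" using n by auto
  have "indep_vars (\<lambda>_. borel) \<epsilon> {1..n}"
    unfolding \<epsilon>_def by (rule indep_vars_compose2[OF assms(6)]) simp
  then have iid: "iid_normal M \<sigma> {1..n} \<epsilon>"
    unfolding iid_normal_iff[OF K(2) \<sigma>] using assms(7) by (simp add: \<epsilon>_def)
  have "orthonormal_rows {1..n} {3..n} G"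
    unfolding G_def by (rule orthonormal_residual_transform[OF n t1 t2 e \<alpha> \<beta>])
  then have "iid_normal M \<sigma> {3..n} (\<lambda>j \<omega>. \<Sum>k=1..n. G j k * \<epsilon> k \<omega>)"
    by (intro iid_normal_orthonormal_rows[OF _ _ K(1) \<sigma> iid]) simp_all
  then have iidG: "iid_normal M \<sigma> {1..n-2} (\<lambda>j \<omega>. \<Sum>k=1..n. G (j + 2) k * \<epsilon> k \<omega>)"
    by (rule iid_normal_reindex[where f = "\<lambda>j. j + 2"]) (auto simp: \<sigma> inj_on_def)
  have R: "R j \<omega> = (\<Sum>k=1..n. residual_proj n t j k * \<epsilon> k \<omega>)"
    if "\<omega> \<in> space M" "j \<in> {1..n}" for j \<omega>
    unfolding assms(9) residual_def \<epsilon>_def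
    by (rule residual_eq_residual_proj[OF n1 t1 t2 ls[OF that(1)] that(2)])
  have W: "W j \<omega> = (\<Sum>k=1..n. G (j + 2) k * \<epsilon> k \<omega>)"
    if "\<omega> \<in> space M" "j \<in> {1..n-2}" for j \<omega>
  proof -
    have j: "j + 2 \<in> {1..n}" "1 \<in> {1..n}" "2 \<in> {1..n}" using that n by auto
    have "(\<Sum>k=1..n. G (j + 2) k * \<epsilon> k \<omega>) =
        R (j + 2) \<omega> + (A + C * t (j + 2)) * R 1 \<omega> + (B + D * t (j + 2)) * R 2 \<omega>"
      unfolding R[OF that(1) j(1)] R[OF that(1) j(2)] R[OF that(1) j(3)]
      by (simp add: G_def sum_distrib_left sum.distrib[symmetric] algebra_simps)
    then show ?thesis
      unfolding assms(10) transformed_residual_def by (simp add: algebra_simps)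
  qed
  \<comment> \<open>The linear formula for \<open>W\<close> is known only on \<open>space M\<close>,
    so measurability and law are transferred by congruence there instead of by rewriting.\<close>
  have iidW: "iid_normal M \<sigma> {1..n-2} W"
  proof -
    have "W j \<in> borel_measurable M \<longleftrightarrow> (\<lambda>\<omega>. \<Sum>k=1..n. G (j + 2) k * \<epsilon> k \<omega>) \<in> borel_measurable M"
      if "j \<in> {1..n-2}" for j
      using W that by (intro measurable_cong) simp
    moreover have "distr M (PiM {1..n-2} (\<lambda>_. borel)) (\<lambda>\<omega>. \<lambda>j\<in>{1..n-2}. W j \<omega>) =
        distr M (PiM {1..n-2} (\<lambda>_. borel)) (\<lambda>\<omega>. \<lambda>j\<in>{1..n-2}. \<Sum>k=1..n. G (j + 2) k * \<epsilon> k \<omega>)"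
      using W by (intro distr_cong) (auto simp: fun_eq_iff)
    ultimately show ?thesis
      using iidG unfolding iid_normal_def by simp
  qed
  have "(\<Sum>j=1..n-2. (W j \<omega>)\<^sup>2) = (\<Sum>j=1..n. (R j \<omega>)\<^sup>2)" if "\<omega> \<in> space M" for \<omega>
  proof -
    have r: "(\<Sum>j=1..n. R j \<omega>) = 0" "(\<Sum>j=1..n. t j * R j \<omega>) = 0"
      using least_squares_normal_equations[OF n1 t1 t2 ls[OF that]]
      by (simp_all add: assms(9) residual_def)
    show ?thesis
      using sum_squares_transformed[OF n t1 t2 r e p[OF r] q[OF r]]
      by (simp add: assms(10) transformed_residual_def add.assoc)
  qed
  then show ?thesis
    using iidW unfolding iid_normal_iff[OF K(3) \<sigma>] by blast
qed

end
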